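(* Let $R$ be a $UJ^{\#}$ ring, and set $\bar R := R/J(R)$. The following two points are valid: (1) For any $u_1,u_2\in U(R)$, it follows that $u_1+u_2\neq 1$. (2) For any $\bar u_1,\bar u_2\in U(\bar R)$, it follows that $\bar u_1+\bar u_2\neq \bar 1$.
   Context: All rings are associative with identity. For a ring $R$, $J(R)$ is the Jacobson radical and $U(R)$ the group of units; $\bar 1$ is the identity of $\bar R$. Define $J^{\#}(R)=\{z\in R : z^n\in J(R)\text{ for some } n\ge 1\}$. A ring $R$ is called a $UJ^{\#}$ ring if $U(R)=1+J^{\#}(R)$. *)

theory Defs
  imports "HOL-Algebra.QuotRing"
begin

text \<open>
  Rings are not assumed commutative. The maximal ideals of HOL-Algebra (\<^locale>\<open>maximalideal\<close>) are
  two-sided, whereas the Jacobson radical is the intersection of the maximal left ideals.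
\<close>

definition left_ideal :: "'a set \<Rightarrow> ('a, 'b) ring_scheme \<Rightarrow> bool" where
  "left_ideal I R \<longleftrightarrow>
     additive_subgroup I R \<and> (\<forall>r\<in>carrier R. \<forall>x\<in>I. r \<otimes>\<^bsub>R\<^esub> x \<in> I)"

definition maximal_left_ideal :: "'a set \<Rightarrow> ('a, 'b) ring_scheme \<Rightarrow> bool" where
  "maximal_left_ideal M R \<longleftrightarrow>
     left_ideal M R \<and> M \<noteq> carrier R \<and>
     (\<forall>I. left_ideal I R \<and> M \<subseteq> I \<longrightarrow> I = M \<or> I = carrier R)"

text \<open>
  Intersecting with the carrier only matters for the zero ring, which has no maximal left ideals.
\<close>

definition jacobson_radical :: "('a, 'b) ring_scheme \<Rightarrow> 'a set" where
  "jacobson_radical R = carrier R \<inter> \<Inter> {M. maximal_left_ideal M R}"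

definition J_sharp :: "('a, 'b) ring_scheme \<Rightarrow> 'a set" where
  "J_sharp R = {z \<in> carrier R. \<exists>n::nat. n \<ge> 1 \<and> z [^]\<^bsub>R\<^esub> n \<in> jacobson_radical R}"

definition UJ_sharp_ring :: "('a, 'b) ring_scheme \<Rightarrow> bool" where
  "UJ_sharp_ring R \<longleftrightarrow>
     ring R \<and> Units R = {\<one>\<^bsub>R\<^esub> \<oplus>\<^bsub>R\<^esub> z | z. z \<in> J_sharp R}"

end

theory Submission
  imports Defs "HOL-Algebra.Multiplicative_Group"
begin

text \<open>
  If \<open>u\<^sub>1 + u\<^sub>2 = 1\<close> with units \<open>u\<^sub>1 = 1 + z\<close>, \<open>z\<close> having a power in \<open>J(R)\<close>, then \<open>z = -u\<^sub>2\<close> is a unit,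
  so \<open>J(R)\<close> contains a unit, which is impossible in a nonzero ring. The second point reduces to the
  first because every element of \<open>1 + J(R)\<close> is a unit, so that elements of \<open>R\<close> invertible modulo
  \<open>J(R)\<close> are units.
\<close>

context ring
begin

section \<open>Left ideals and the existence of maximal ones\<close>

lemma left_idealI:
  assumes "I \<subseteq> carrier R" "\<zero> \<in> I"
    and "\<And>x y. x \<in> I \<Longrightarrow> y \<in> I \<Longrightarrow> x \<oplus> y \<in> I"
    and "\<And>r x. r \<in> carrier R \<Longrightarrow> x \<in> I \<Longrightarrow> r \<otimes> x \<in> I"
  shows "left_ideal I R"
proof -
  \<comment> \<open>Negation is left multiplication by \<open>\<ominus> \<one>\<close>, so
    absorption on the left already makes the subset an additive subgroup.\<close>
  have "\<ominus> x \<in> I" if "x \<in> I" for x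
  proof -
    have "(\<ominus> \<one>) \<otimes> x \<in> I" using assms(4) that by blast
    moreover have "(\<ominus> \<one>) \<otimes> x = \<ominus> x"
      using that assms(1) by (simp add: l_minus subset_iff)
    ultimately show ?thesis by simp
  qed
  then have "subgroup I (add_monoid R)"
    using assms(1-3) by (auto intro!: add.subgroupI simp: a_inv_def)
  then show ?thesis
    using assms(4) by (auto simp: left_ideal_def intro: additive_subgroup.intro)
qed

lemma left_idealD:
  assumes "left_ideal I R"
  shows "I \<subseteq> carrier R" "\<zero> \<in> I"
    and "\<And>x y. x \<in> I \<Longrightarrow> y \<in> I \<Longrightarrow> x \<oplus> y \<in> I"
    and "\<And>r x. r \<in> carrier R \<Longrightarrow> x \<in> I \<Longrightarrow> r \<otimes> x \<in> I"
proof -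
  interpret additive_subgroup I R using assms by (simp add: left_ideal_def)
  show "I \<subseteq> carrier R" by (rule a_subset)
  show "\<zero> \<in> I" by (rule zero_closed)
  show "\<And>x y. x \<in> I \<Longrightarrow> y \<in> I \<Longrightarrow> x \<oplus> y \<in> I" by (rule a_closed)
  show "\<And>r x. r \<in> carrier R \<Longrightarrow> x \<in> I \<Longrightarrow> r \<otimes> x \<in> I"
    using assms by (simp add: left_ideal_def)
qed

lemma left_ideal_eq_carrier_iff:
  assumes "left_ideal I R"
  shows "I = carrier R \<longleftrightarrow> \<one> \<in> I"
proof
  assume "\<one> \<in> I"
  then have "x \<in> I" if "x \<in> carrier R" for x
    using left_idealD(4)[OF assms that] that by fastforce
  then show "I = carrier R" using left_idealD(1)[OF assms] by blast
qed simp

text \<open>Serves two purposes: with \<open>I = {\<zero>}\<close> it yields principal left ideals,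
  and with \<open>I\<close> maximal it is the enlargement of \<open>I\<close> by an outside element
  that must be the whole ring.\<close>

lemma left_ideal_add_principal:
  assumes I: "left_ideal I R" and a: "a \<in> carrier R"
  shows "left_ideal {m \<oplus> r \<otimes> a | m r. m \<in> I \<and> r \<in> carrier R} R" (is "left_ideal ?K R")
proof (rule left_idealI)
  note D = left_idealD[OF I]
  show "?K \<subseteq> carrier R" using D(1) a by auto
  have "\<zero> = \<zero> \<oplus> \<zero> \<otimes> a" using a by simp
  then show "\<zero> \<in> ?K" using D(2) by blast
  show "x \<oplus> y \<in> ?K" if xy: "x \<in> ?K" "y \<in> ?K" for x y
  proof -
    obtain m r n s where x: "x = m \<oplus> r \<otimes> a" "m \<in> I" "r \<in> carrier R"
      and y: "y = n \<oplus> s \<otimes> a" "n \<in> I" "s \<in> carrier R"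
      using xy by blast
    have "m \<in> carrier R" "n \<in> carrier R" using x y D(1) by auto
    then have "x \<oplus> y = (m \<oplus> n) \<oplus> (r \<oplus> s) \<otimes> a" using x y a by (simp add: l_distr a_ac)
    then show ?thesis using D(3) x y by blast
  qed
  show "t \<otimes> x \<in> ?K" if t: "t \<in> carrier R" and x_mem: "x \<in> ?K" for t x
  proof -
    obtain m r where x: "x = m \<oplus> r \<otimes> a" "m \<in> I" "r \<in> carrier R"
      using x_mem by blast
    have "m \<in> carrier R" using x D(1) by auto
    then have "t \<otimes> x = t \<otimes> m \<oplus> (t \<otimes> r) \<otimes> a" using x a t by (simp add: r_distr m_assoc)
    then show ?thesis using D(4) x t by blast
  qed
qed

lemma zero_left_ideal: "left_ideal {\<zero>} R"
  by (rule left_idealI) auto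

lemma principal_left_ideal:
  assumes "a \<in> carrier R"
  shows "left_ideal {r \<otimes> a | r. r \<in> carrier R} R"
proof -
  have "{m \<oplus> r \<otimes> a | m r. m \<in> {\<zero>} \<and> r \<in> carrier R} = {r \<otimes> a | r. r \<in> carrier R}"
    using assms by force
  then show ?thesis using left_ideal_add_principal[OF zero_left_ideal assms] by simp
qed

text \<open>Zorn's lemma. Properness is expressed as \<open>\<one> \<notin> K\<close>, a condition
  that visibly survives unions of chains.\<close>

lemma exists_maximal_left_ideal:
  assumes I: "left_ideal I R" "\<one> \<notin> I"
  obtains M where "maximal_left_ideal M R" "I \<subseteq> M"
proof -
  define A where "A = {K. left_ideal K R \<and> \<one> \<notin> K \<and> I \<subseteq> K}"
  have "\<exists>M\<in>A. \<forall>X\<in>A. M \<subseteq> X \<longrightarrow> X = M"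
  proof (rule subset_Zorn_nonempty)
    show "A \<noteq> {}" using I by (auto simp: A_def)
  next
    fix C assume "C \<noteq> {}" and C: "subset.chain A C"
    \<comment> \<open>A member of the chain is needed to see that the union contains
      \<open>\<zero>\<close> and \<open>I\<close>.\<close>
    then obtain K0 where K0: "K0 \<in> C" by blast
    have CA: "\<And>K. K \<in> C \<Longrightarrow> left_ideal K R \<and> \<one> \<notin> K \<and> I \<subseteq> K"
      using C by (auto simp: A_def subset_chain_def)
    have "left_ideal (\<Union>C) R"
    proof (rule left_idealI)
      show "\<Union>C \<subseteq> carrier R" using CA left_idealD(1) by blast
      show "\<zero> \<in> \<Union>C" using CA left_idealD(2) K0 by blast
      show "x \<oplus> y \<in> \<Union>C" if xy: "x \<in> \<Union>C" "y \<in> \<Union>C" for x y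
      proof -
        obtain X Y where XY: "X \<in> C" "x \<in> X" "Y \<in> C" "y \<in> Y" using xy by blast
        then have "X \<subseteq> Y \<or> Y \<subseteq> X" using C by (auto simp: subset_chain_def)
        then show ?thesis using XY CA left_idealD(3) by (meson UnionI subsetD)
      qed
      show "r \<otimes> x \<in> \<Union>C" if "r \<in> carrier R" "x \<in> \<Union>C" for r x
        using that CA left_idealD(4) by blast
    qed
    then show "\<Union>C \<in> A" using CA K0 unfolding A_def by blast
  qed
  then obtain M where M: "M \<in> A" "\<And>X. X \<in> A \<Longrightarrow> M \<subseteq> X \<Longrightarrow> X = M" by blast
  then have MA: "left_ideal M R" "\<one> \<notin> M" "I \<subseteq> M" by (auto simp: A_def)
  \<comment> \<open>Either \<open>K\<close> omits \<open>\<one>\<close>, hence lies in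
    \<open>A\<close> and equals \<open>M\<close>, or it contains \<open>\<one>\<close> and is
    everything.\<close>
  have "K = M \<or> K = carrier R" if K: "left_ideal K R" "M \<subseteq> K" for K
    using M(2)[of K] K MA(3) left_ideal_eq_carrier_iff[OF K(1)] unfolding A_def by blast
  then have "maximal_left_ideal M R"
    using MA left_ideal_eq_carrier_iff[OF MA(1)] by (auto simp: maximal_left_ideal_def)
  then show thesis using MA(3) that by blast
qed

section \<open>The Jacobson radical: invertibility of 1 + x and two-sidedness\<close>

lemma maximal_left_ideal_one_notin:
  assumes "maximal_left_ideal M R"
  shows "\<one> \<notin> M"
  using assms left_ideal_eq_carrier_iff unfolding maximal_left_ideal_def by blast

lemma left_ideal_jacobson_radical: "left_ideal (jacobson_radical R) R"
proof -
  have "left_ideal M R" if "maximal_left_ideal M R" for M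
    using that by (simp add: maximal_left_ideal_def)
  then show ?thesis
    by (intro left_idealI) (auto simp: jacobson_radical_def dest: left_idealD)
qed

lemmas jacobson_radical_left_ideal = left_idealD[OF left_ideal_jacobson_radical]

lemma jacobson_radical_one_notin:
  assumes "\<one> \<noteq> \<zero>"
  shows "\<one> \<notin> jacobson_radical R"
proof -
  obtain M where "maximal_left_ideal M R"
    using exists_maximal_left_ideal[OF zero_left_ideal] assms by blast
  then show ?thesis
    using maximal_left_ideal_one_notin by (auto simp: jacobson_radical_def)
qed

text \<open>If the left ideal generated by \<open>\<one> \<oplus> x\<close> were proper, some
  maximal left ideal would contain it. That ideal also contains \<open>x\<close>, hence their
  difference \<open>\<one>\<close>.\<close>

lemma jacobson_radical_left_inverse:
  assumes x: "x \<in> jacobson_radical R"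
  obtains y where "y \<in> carrier R" "y \<otimes> (\<one> \<oplus> x) = \<one>"
proof -
  have xc: "x \<in> carrier R" using x by (simp add: jacobson_radical_def)
  let ?P = "{r \<otimes> (\<one> \<oplus> x) | r. r \<in> carrier R}"
  have "\<one> \<in> ?P"
  proof (rule ccontr)
    assume "\<one> \<notin> ?P"
    moreover have "left_ideal ?P R" using principal_left_ideal xc by simp
    ultimately obtain M where M: "maximal_left_ideal M R" "?P \<subseteq> M"
      using exists_maximal_left_ideal by blast
    have li: "left_ideal M R" using M(1) by (simp add: maximal_left_ideal_def)
    have "\<one> \<otimes> (\<one> \<oplus> x) \<in> M" using M(2) by blast
    moreover have "(\<ominus> \<one>) \<otimes> x \<in> M"
      using x M(1) left_idealD(4)[OF li] by (auto simp: jacobson_radical_def)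
    ultimately have "\<one> \<otimes> (\<one> \<oplus> x) \<oplus> (\<ominus> \<one>) \<otimes> x \<in> M" using left_idealD(3)[OF li] by blast
    moreover have "\<one> \<otimes> (\<one> \<oplus> x) \<oplus> (\<ominus> \<one>) \<otimes> x = \<one>"
      using xc by (simp add: l_minus a_assoc r_neg)
    ultimately show False using maximal_left_ideal_one_notin[OF M(1)] by simp
  qed
  then show thesis using that by force
qed

text \<open>The left inverse \<open>y\<close> of \<open>\<one> \<oplus> x\<close> equals 1 - yx,
  which is again 1 plus an element of the radical. So \<open>y\<close> has a left inverse
  \<open>z\<close> as well as the right inverse \<open>\<one> \<oplus> x\<close>; the two coincide,
  and \<open>y\<close> is a two-sided inverse.\<close>

lemma one_plus_jacobson_radical_Units:
  assumes x: "x \<in> jacobson_radical R"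
  shows "\<one> \<oplus> x \<in> Units R"
proof -
  have xc: "x \<in> carrier R" using x by (simp add: jacobson_radical_def)
  obtain y where y: "y \<in> carrier R" "y \<otimes> (\<one> \<oplus> x) = \<one>"
    using jacobson_radical_left_inverse[OF x] by blast
  have "(\<ominus> y) \<otimes> x \<in> jacobson_radical R"
    using jacobson_radical_left_ideal(4) x y(1) by simp
  then obtain z where z: "z \<in> carrier R" "z \<otimes> (\<one> \<oplus> (\<ominus> y) \<otimes> x) = \<one>"
    using jacobson_radical_left_inverse by blast
  have "y \<oplus> y \<otimes> x = \<one>" using y xc by (simp add: r_distr)
  then have "\<one> \<oplus> (\<ominus> y) \<otimes> x = y"
    using y(1) xc by (metis a_assoc l_minus m_closed a_inv_closed r_neg r_zero)
  then have zy: "z \<otimes> y = \<one>" using z by simp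
  have "z = \<one> \<oplus> x" using inv_unique[OF zy y(2)] y(1) z(1) xc by simp
  then have "(\<one> \<oplus> x) \<otimes> y = \<one>" using zy by simp
  then show ?thesis using y xc by (auto simp: Units_def)
qed

text \<open>Needed for the quotient ring to make sense, and not evident from an intersection of left
  ideals. If xr lies outside a maximal \<open>M\<close>, then 1 = m + sxr with m in
  \<open>M\<close>, so rm = (1 - rsx)r. The factor 1 - rsx is left invertible because rsx is in the
  radical, which forces r, and then xr, into \<open>M\<close>.\<close>

lemma jacobson_radical_right_mult:
  assumes x: "x \<in> jacobson_radical R" and r: "r \<in> carrier R"
  shows "x \<otimes> r \<in> jacobson_radical R"
proof -
  have xc: "x \<in> carrier R" using x by (simp add: jacobson_radical_def)
  have "x \<otimes> r \<in> M" if M: "maximal_left_ideal M R" for M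
  proof (rule ccontr)
    assume n: "x \<otimes> r \<notin> M"
    have li: "left_ideal M R" using M by (simp add: maximal_left_ideal_def)
    note D = left_idealD[OF li]
    let ?K = "{m \<oplus> s \<otimes> (x \<otimes> r) | m s. m \<in> M \<and> s \<in> carrier R}"
    have K: "left_ideal ?K R" using left_ideal_add_principal[OF li] xc r by simp
    have "m \<in> ?K" if m: "m \<in> M" for m
    proof -
      have "m = m \<oplus> \<zero> \<otimes> (x \<otimes> r)" using m D(1) xc r by auto
      then show ?thesis using m by blast
    qed
    then have MK: "M \<subseteq> ?K" by blast
    have "x \<otimes> r = \<zero> \<oplus> \<one> \<otimes> (x \<otimes> r)" using xc r by simp
    then have "x \<otimes> r \<in> ?K" using D(2) by blast
    then have "?K = carrier R" using K MK M n unfolding maximal_left_ideal_def by blast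
    then have "\<one> \<in> ?K" by simp
    then obtain m s where ms: "\<one> = m \<oplus> s \<otimes> (x \<otimes> r)" "m \<in> M" "s \<in> carrier R" by blast
    have mc: "m \<in> carrier R" using ms D(1) by blast
    \<comment> \<open>Chosen so that \<open>\<one> \<oplus> ?w \<otimes> x\<close> is the factor 1 -
      rsx.\<close>
    let ?w = "\<ominus> (r \<otimes> s)"
    have "?w \<otimes> x \<in> jacobson_radical R"
      using jacobson_radical_left_ideal(4) x r ms(3) by simp
    then obtain y where y: "y \<in> carrier R" "y \<otimes> (\<one> \<oplus> ?w \<otimes> x) = \<one>"
      using jacobson_radical_left_inverse by blast
    have "r \<otimes> m \<oplus> (r \<otimes> s \<otimes> x) \<otimes> r = r \<otimes> (m \<oplus> s \<otimes> (x \<otimes> r))"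
      using ms(3) mc xc r by (simp add: r_distr m_assoc)
    also have "\<dots> = r" using ms(1)[symmetric] r by simp
    finally have "r \<otimes> m = r \<oplus> \<ominus> ((r \<otimes> s \<otimes> x) \<otimes> r)"
      using ms(3) mc xc r by (subst add.inv_solve_right[folded a_inv_def]) simp_all
    also have "\<dots> = (\<one> \<oplus> ?w \<otimes> x) \<otimes> r" using ms(3) xc r by (simp add: l_distr l_minus)
    finally have "y \<otimes> (r \<otimes> m) = y \<otimes> ((\<one> \<oplus> ?w \<otimes> x) \<otimes> r)" by simp
    also have "\<dots> = (y \<otimes> (\<one> \<oplus> ?w \<otimes> x)) \<otimes> r" using y(1) ms(3) xc r by (simp add: m_assoc)
    also have "\<dots> = r" using y r by simp
    finally have "y \<otimes> (r \<otimes> m) = r" .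
    then have "r \<in> M" using D(4) y(1) r ms(2) by metis
    then show False using D(4) xc n by blast
  qed
  then show ?thesis using xc r by (auto simp: jacobson_radical_def)
qed

section \<open>The quotient by the radical and lifting of units\<close>

lemma ideal_jacobson_radical: "ideal (jacobson_radical R) R"
  using left_ideal_jacobson_radical jacobson_radical_right_mult
  unfolding left_ideal_def
  by (intro idealI) (auto simp: ring_axioms additive_subgroup.a_subgroup)

text \<open>Without commutativity a unit ab only provides a right inverse \<open>c\<close> of a; the
  unit ba provides a left inverse \<open>d\<close>, and the two must agree.\<close>

lemma Units_if_two_sided_products_Units:
  assumes a: "a \<in> carrier R" and b: "b \<in> carrier R"
    and u: "a \<otimes> b \<in> Units R" and v: "b \<otimes> a \<in> Units R"
  shows "a \<in> Units R"
proof -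
  define c where "c = b \<otimes> inv (a \<otimes> b)"
  define d where "d = inv (b \<otimes> a) \<otimes> b"
  have cd: "c \<in> carrier R" "d \<in> carrier R" using b u v by (auto simp: c_def d_def)
  have ac: "a \<otimes> c = \<one>" using a b u by (simp add: c_def Units_r_inv flip: m_assoc)
  have da: "d \<otimes> a = \<one>" using a b v by (simp add: d_def Units_l_inv m_assoc)
  have "d = c" using inv_unique[OF da ac] a cd by simp
  then show ?thesis using ac da cd a by (auto simp: Units_def)
qed

lemma Units_if_Units_mod_jacobson_radical:
  assumes a: "a \<in> carrier R"
    and U: "jacobson_radical R +> a \<in> Units (R Quot jacobson_radical R)"
  shows "a \<in> Units R"
proof -
  let ?J = "jacobson_radical R" and ?Q = "R Quot jacobson_radical R"
  interpret J: ideal ?J R by (rule ideal_jacobson_radical)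
  interpret h: ring_hom_ring R ?Q "(+>) ?J" by (rule J.rcos_ring_hom_ring)
  obtain w where w: "w \<in> carrier ?Q" "w \<otimes>\<^bsub>?Q\<^esub> (?J +> a) = \<one>\<^bsub>?Q\<^esub>" "(?J +> a) \<otimes>\<^bsub>?Q\<^esub> w = \<one>\<^bsub>?Q\<^esub>"
    using U unfolding Units_def by blast
  obtain b where b: "b \<in> carrier R" "w = ?J +> b"
    using w(1) unfolding FactRing_def A_RCOSETS_def' by auto
  \<comment> \<open>To be applied to \<open>a \<otimes> b\<close> and \<open>b \<otimes> a\<close>:
    these need not be \<open>\<one>\<close>, but both are congruent to \<open>\<one>\<close> modulo
    the radical.\<close>
  have lift: "c \<in> Units R" if c: "c \<in> carrier R" "?J +> c = \<one>\<^bsub>?Q\<^esub>" for c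
  proof -
    have "c \<in> ?J +> \<one>" using J.a_rcos_self[OF c(1)] c(2) h.hom_one by simp
    then obtain x where x: "x \<in> ?J" "c = x \<oplus> \<one>" by (auto simp: a_r_coset_def')
    then show ?thesis using one_plus_jacobson_radical_Units[OF x(1)] J.a_subset
      by (metis a_comm one_closed subsetD)
  qed
  have "a \<otimes> b \<in> Units R" "b \<otimes> a \<in> Units R"
    using w(2,3) a b(1) lift unfolding b(2) by (simp_all flip: h.hom_mult)
  then show ?thesis using Units_if_two_sided_products_Units a b by blast
qed

lemma jacobson_radical_no_Units:
  assumes "\<one> \<noteq> \<zero>" "u \<in> Units R"
  shows "u \<notin> jacobson_radical R"
proof
  assume "u \<in> jacobson_radical R"
  then have "inv u \<otimes> u \<in> jacobson_radical R"
    by (rule jacobson_radical_left_ideal(4)[OF Units_inv_closed[OF assms(2)]])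
  then show False
    using jacobson_radical_one_notin[OF assms(1)] by (simp add: Units_l_inv[OF assms(2)])
qed

lemma J_sharp_no_Units:
  assumes "\<one> \<noteq> \<zero>" "u \<in> Units R"
  shows "u \<notin> J_sharp R"
  using jacobson_radical_no_Units[OF assms(1) Units_pow_closed[OF assms(2)]]
  by (simp add: J_sharp_def)

end

section \<open>Sums of two units in a UJ-sharp ring\<close>

lemma UJ_sharp_ring_units_sum:
  fixes R (structure)
  assumes R: "UJ_sharp_ring R" and nz: "\<one> \<noteq> \<zero>"
    and u: "u\<^sub>1 \<in> Units R" "u\<^sub>2 \<in> Units R"
  shows "u\<^sub>1 \<oplus> u\<^sub>2 \<noteq> \<one>"
proof
  assume s: "u\<^sub>1 \<oplus> u\<^sub>2 = \<one>"
  interpret ring R using R by (simp add: UJ_sharp_ring_def)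
  obtain z where z: "z \<in> J_sharp R" "u\<^sub>1 = \<one> \<oplus> z"
    using R u(1) unfolding UJ_sharp_ring_def by blast
  have c: "z \<in> carrier R" "u\<^sub>2 \<in> carrier R" using z u by (auto simp: J_sharp_def)
  have "\<one> \<oplus> (z \<oplus> u\<^sub>2) = \<one>" using s z(2) c by (simp add: a_assoc)
  then have "z \<oplus> u\<^sub>2 = \<zero>" using c by (simp add: add.r_cancel_one)
  then have "z = \<ominus> u\<^sub>2" using c by (simp add: minus_equality)
  moreover have "\<ominus> u\<^sub>2 \<in> Units R"
    using Units_m_closed[OF Units_minus_one_closed u(2)] c(2) by (simp add: l_minus)
  ultimately show False using J_sharp_no_Units[OF nz] z(1) by simp
qed

text \<open>The second assumption excludes the zero ring, which satisfies
  \<open>UJ_sharp_ring\<close> although its only element is a unit with 0 + 0 = 1. For the second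
  point \<open>Rbar\<close> is not shown to be a UJ-sharp ring; a bad pair of units is lifted to
  \<open>R\<close> instead.\<close>

theorem proposition2p13:
  fixes R :: "('a, 'b) ring_scheme" and Rbar :: "'a set ring"
  assumes "UJ_sharp_ring R"
    and "\<one>\<^bsub>R\<^esub> \<noteq> \<zero>\<^bsub>R\<^esub>"
  defines "Rbar \<equiv> R Quot (jacobson_radical R)"
  shows "(\<forall>u\<^sub>1\<in>Units R. \<forall>u\<^sub>2\<in>Units R. u\<^sub>1 \<oplus>\<^bsub>R\<^esub> u\<^sub>2 \<noteq> \<one>\<^bsub>R\<^esub>) \<and>
         (\<forall>v\<^sub>1\<in>Units Rbar. \<forall>v\<^sub>2\<in>Units Rbar. v\<^sub>1 \<oplus>\<^bsub>Rbar\<^esub> v\<^sub>2 \<noteq> \<one>\<^bsub>Rbar\<^esub>)"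
proof (intro conjI ballI)
  show "u\<^sub>1 \<oplus>\<^bsub>R\<^esub> u\<^sub>2 \<noteq> \<one>\<^bsub>R\<^esub>" if "u\<^sub>1 \<in> Units R" "u\<^sub>2 \<in> Units R" for u\<^sub>1 u\<^sub>2
    using that by (rule UJ_sharp_ring_units_sum[OF assms(1,2)])
next
  fix v\<^sub>1 v\<^sub>2 assume v: "v\<^sub>1 \<in> Units Rbar" "v\<^sub>2 \<in> Units Rbar"
  interpret ring R using assms(1) by (simp add: UJ_sharp_ring_def)
  let ?J = "jacobson_radical R"
  interpret J: ideal ?J R by (rule ideal_jacobson_radical)
  interpret h: ring_hom_ring R Rbar "a_r_coset R ?J"
    unfolding Rbar_def by (rule J.rcos_ring_hom_ring)
  show "v\<^sub>1 \<oplus>\<^bsub>Rbar\<^esub> v\<^sub>2 \<noteq> \<one>\<^bsub>Rbar\<^esub>"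
  proof
    assume s: "v\<^sub>1 \<oplus>\<^bsub>Rbar\<^esub> v\<^sub>2 = \<one>\<^bsub>Rbar\<^esub>"
    have vc: "v\<^sub>1 \<in> carrier Rbar" "v\<^sub>2 \<in> carrier Rbar" using v by auto
    obtain a where a: "a \<in> carrier R" "v\<^sub>1 = ?J +>\<^bsub>R\<^esub> a"
      using vc(1) unfolding Rbar_def FactRing_def A_RCOSETS_def' by auto
    \<comment> \<open>An arbitrary representative of \<open>v\<^sub>2\<close> would give sum 1 only
      modulo the radical. This one represents \<open>v\<^sub>2\<close> because the two cosets sum to
      1, and its sum with \<open>a\<close> is exactly 1 in \<open>R\<close>.\<close>
    let ?b = "\<one>\<^bsub>R\<^esub> \<ominus>\<^bsub>R\<^esub> a"
    have b: "?b \<in> carrier R" using a by simp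
    have "?J +>\<^bsub>R\<^esub> ?b = \<one>\<^bsub>Rbar\<^esub> \<ominus>\<^bsub>Rbar\<^esub> v\<^sub>1" using a by (simp add: a_minus_def)
    also have "\<dots> = v\<^sub>2"
      unfolding s[symmetric] h.S.a_comm[OF vc]
      using vc by (simp add: h.S.minus_eq h.S.a_assoc h.S.r_neg)
    finally have "?J +>\<^bsub>R\<^esub> ?b \<in> Units Rbar" "?J +>\<^bsub>R\<^esub> a \<in> Units Rbar"
      using v a(2) by simp_all
    then have "?b \<in> Units R" "a \<in> Units R"
      using Units_if_Units_mod_jacobson_radical a(1) b unfolding Rbar_def by blast+
    moreover have "a \<oplus>\<^bsub>R\<^esub> ?b = \<one>\<^bsub>R\<^esub>"
      using a(1) by (simp add: minus_eq a_lcomm[of a "\<one>\<^bsub>R\<^esub>"] r_neg)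
    ultimately show False using UJ_sharp_ring_units_sum[OF assms(1,2)] by blast
  qed
qed

end
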